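(* Let $\mathcal{H}$ be a complex separable Hilbert space, let $\mathcal{S}$ be a closed subspace of $\mathcal{H}$, and let $W$ be a bounded selfadjoint operator on $\mathcal{H}$ with matrix representation $W=\begin{pmatrix} a&b\\ b^*&c\end{pmatrix}_{\mathcal{S}}$ with respect to $\mathcal{H}=\mathcal{S}\oplus\mathcal{S}^\perp$, where $a,b,c$ are bounded operators. Let $P_{W,\mathcal{S}}=\begin{pmatrix} I&x\\0&0\end{pmatrix}_{\mathcal{S}}$, where $x=-P_{\mathcal{S}}(P_{\mathcal{S}^\perp}|_{(W\mathcal{S})^\perp})^{-1}$ is regarded as a linear relation from $\mathcal{S}^\perp$ to $\mathcal{S}$. Then $W$ is $\mathcal{S}$-complementable if and only if $ax=b$. In this case, $$P_{W,\mathcal{S}}=\begin{pmatrix} I&a^{-1}b\\0&0\end{pmatrix}_{\mathcal{S}}.$$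
   Context: A linear relation from $\mathcal{H}$ to $\mathcal{K}$ is a linear subspace $T$ of $\mathcal{H}\times\mathcal{K}$; operators are identified with their graphs, and equalities such as $ax=b$ are equalities of linear relations. $T^{-1}=\{(y,x):(x,y)\in T\}$ (so $a^{-1}$ is the inverse of $a$ as a relation), $-T=\{(u,-v):(u,v)\in T\}$, $RT=\{(x,y): (x,z)\in T,\ (z,y)\in R\text{ for some }z\}$, $T|_{\mathcal{L}}=\{(x,y)\in T:x\in\mathcal{L}\}$. For a closed subspace $\mathcal{S}$, $P_{\mathcal{S}}$ is the orthogonal projection onto $\mathcal{S}$. For subspaces $\mathcal{M},\mathcal{N}$, $P_{\mathcal{M},\mathcal{N}}:=\{(m+n,m):m\in\mathcal{M},n\in\mathcal{N}\}$, and $P_{W,\mathcal{S}}:=P_{\mathcal{S},(W\mathcal{S})^\perp}$, where $(W\mathcal{S})^\perp=\{x:\langle Wx,s\rangle=0\ \forall s\in\mathcal{S}\}$. $W$ is $\mathcal{S}$-complementable if $\operatorname{dom}P_{W,\mathcal{S}}=\mathcal{H}$, i.e. $\mathcal{S}+(W\mathcal{S})^\perp=\mathcal{H}$. Block matrices: for linear relations $\alpha$ from $\mathcal{S}$ to $\mathcal{S}$, $\beta$ from $\mathcal{S}^\perp$ to $\mathcal{S}$, $\gamma$ from $\mathcal{S}$ to $\mathcal{S}^\perp$, $\delta$ from $\mathcal{S}^\perp$ to $\mathcal{S}^\perp$, $$\begin{pmatrix} \alpha&\beta\\\gamma&\delta\end{pmatrix}_{\mathcal{S}}:=\{(x_1+x_2,(w_1+z_1)+(w_2+z_2)):(x_1,w_1)\in\alpha,\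 (x_2,z_1)\in\beta,\ (x_1,w_2)\in\gamma,\ (x_2,z_2)\in\delta\}.$$ Entries $I$ and $0$ denote the everywhere defined identity and zero operators. *)

theory Defs
  imports "HOL-Analysis.Analysis"
begin

class complex_vector = real_vector +
  fixes scaleC :: "complex \<Rightarrow> 'a \<Rightarrow> 'a"  (infixr \<open>*\<^sub>C\<close> 75)
  assumes scaleC_add_right: "c *\<^sub>C (x + y) = c *\<^sub>C x + c *\<^sub>C y"
    and scaleC_add_left: "(c + d) *\<^sub>C x = c *\<^sub>C x + d *\<^sub>C x"
    and scaleC_scaleC: "c *\<^sub>C d *\<^sub>C x = (c * d) *\<^sub>C x"
    and scaleR_scaleC: "r *\<^sub>R x = complex_of_real r *\<^sub>C x"

lemma scaleC_one: "1 *\<^sub>C x = (x :: 'a::complex_vector)"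
  using scaleR_scaleC[of 1 x] by simp

global_interpretation complex_vector: vector_space "scaleC :: complex \<Rightarrow> 'a \<Rightarrow> 'a::complex_vector"
  defines csubspace = complex_vector.subspace
  by unfold_locales (simp_all add: scaleC_add_right scaleC_add_left scaleC_scaleC scaleC_one)

text \<open>The complex inner product is linear in its first argument. Its real part is the real inner
  product of class \<^class>\<open>real_inner\<close>, which supplies positive definiteness, the norm
  \<open>norm x = sqrt (Re (cinner x x))\<close> and the topology; \<open>cinner x x\<close> is real by
  \<open>cinner_commute\<close>.\<close>

class complex_inner = complex_vector + real_inner +
  fixes cinner :: "'a \<Rightarrow> 'a \<Rightarrow> complex"
  assumes cinner_commute: "cinner x y = cnj (cinner y x)"
    and cinner_add_left: "cinner (x + y) z = cinner x z + cinner y z"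
    and cinner_scaleC_left: "cinner (c *\<^sub>C x) y = c * cinner x y"
    and Re_cinner: "Re (cinner x y) = inner x y"

class complex_hilbert_space = complex_inner + complete_space

instantiation complex :: complex_hilbert_space
begin

definition scaleC_complex :: "complex \<Rightarrow> complex \<Rightarrow> complex"
  where "scaleC_complex c x = c * x"

definition cinner_complex :: "complex \<Rightarrow> complex \<Rightarrow> complex"
  where "cinner_complex x y = x * cnj y"

instance
  by standard
    (auto simp: scaleC_complex_def cinner_complex_def inner_complex_def algebra_simps scaleR_conv_of_real)

end

instantiation prod :: (complex_vector, complex_vector) complex_vector
begin

definition scaleC_prod :: "complex \<Rightarrow> 'a \<times> 'b \<Rightarrow> 'a \<times> 'b"
  where "scaleC_prod c p = (c *\<^sub>C fst p, c *\<^sub>C snd p)"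

instance
  by standard
    (auto simp: scaleC_prod_def scaleC_add_right scaleC_add_left scaleC_scaleC scaleR_prod_def scaleR_scaleC)

end

definition orth_compl :: "'a::complex_inner set \<Rightarrow> 'a set"
  where "orth_compl S = {x. \<forall>s\<in>S. cinner x s = 0}"

definition bounded_clinear :: "('a::complex_inner \<Rightarrow> 'b::complex_inner) \<Rightarrow> bool"
  where "bounded_clinear f \<longleftrightarrow> bounded_linear f \<and> (\<forall>c x. f (c *\<^sub>C x) = c *\<^sub>C f x)"

definition selfadjoint :: "('a::complex_inner \<Rightarrow> 'a) \<Rightarrow> bool"
  where "selfadjoint W \<longleftrightarrow> (\<forall>x y. cinner (W x) y = cinner x (W y))"

definition linear_relation ::
    "'a::complex_vector set \<Rightarrow> 'b::complex_vector set \<Rightarrow> ('a \<times> 'b) set \<Rightarrow> bool"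
  where "linear_relation M N T \<longleftrightarrow> csubspace T \<and> T \<subseteq> M \<times> N"

definition graph :: "('a \<Rightarrow> 'b) \<Rightarrow> ('a \<times> 'b) set"
  where "graph f = {(x, f x) | x. True}"

text \<open>Bounded everywhere defined operators from \<open>M\<close> to \<open>N\<close>, identified with their graphs.\<close>

definition bounded_operator ::
    "'a::complex_inner set \<Rightarrow> 'b::complex_inner set \<Rightarrow> ('a \<times> 'b) set \<Rightarrow> bool"
  where "bounded_operator M N T \<longleftrightarrow>
    linear_relation M N T \<and> single_valued T \<and> Domain T = M \<and>
    (\<exists>K. \<forall>(x, y)\<in>T. norm y \<le> K * norm x)"

text \<open>The adjoint of \<open>T\<close> as a relation from \<open>M\<close> to \<open>N\<close>; it is a relation from \<open>N\<close> to \<open>M\<close>.\<close>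

definition rel_adjoint ::
    "'a::complex_inner set \<Rightarrow> 'b::complex_inner set \<Rightarrow> ('a \<times> 'b) set \<Rightarrow> ('b \<times> 'a) set"
  where "rel_adjoint M N T = {(u, v). u \<in> N \<and> v \<in> M \<and> (\<forall>(x, y)\<in>T. cinner y u = cinner x v)}"

text \<open>The inverse of a relation is its converse \<open>T\<inverse>\<close>. The product applies the right factor first,
  opposite to \<open>O\<close>.\<close>

definition rel_mult :: "('b \<times> 'c) set \<Rightarrow> ('a \<times> 'b) set \<Rightarrow> ('a \<times> 'c) set"  (infixr \<open>\<circ>\<^sub>r\<close> 75)
  where "R \<circ>\<^sub>r T = T O R"

definition rel_uminus :: "('a \<times> 'b::uminus) set \<Rightarrow> ('a \<times> 'b) set"
  where "rel_uminus T = {(u, - v) | u v. (u, v) \<in> T}"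

definition rel_restrict :: "('a \<times> 'b) set \<Rightarrow> 'a set \<Rightarrow> ('a \<times> 'b) set"
  where "rel_restrict T L = {(x, y) \<in> T. x \<in> L}"

definition proj_rel :: "'a::complex_vector set \<Rightarrow> 'a set \<Rightarrow> ('a \<times> 'a) set"
  where "proj_rel M N = {(m + n, m) | m n. m \<in> M \<and> n \<in> N}"

text \<open>For a closed subspace \<open>S\<close> of a Hilbert space this is the graph of the orthogonal projection
  onto \<open>S\<close>.\<close>

definition orth_proj :: "'a::complex_inner set \<Rightarrow> ('a \<times> 'a) set"
  where "orth_proj S = proj_rel S (orth_compl S)"

text \<open>The space \<open>(WS)\<^sup>\<bottom>\<close>. For selfadjoint \<open>W\<close> it is the orthogonal complement of \<open>W ` S\<close>.\<close>

definition W_orth :: "('a::complex_inner \<Rightarrow> 'a) \<Rightarrow> 'a set \<Rightarrow> 'a set"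
  where "W_orth W S = {x. \<forall>s\<in>S. cinner (W x) s = 0}"

lemma W_orth_eq_orth_compl: "selfadjoint W \<Longrightarrow> W_orth W S = orth_compl (W ` S)"
  by (simp add: W_orth_def orth_compl_def selfadjoint_def)

definition W_proj :: "('a::complex_inner \<Rightarrow> 'a) \<Rightarrow> 'a set \<Rightarrow> ('a \<times> 'a) set"
  where "W_proj W S = proj_rel S (W_orth W S)"

definition complementable :: "('a::complex_inner \<Rightarrow> 'a) \<Rightarrow> 'a set \<Rightarrow> bool"
  where "complementable W S \<longleftrightarrow> Domain (W_proj W S) = UNIV"

text \<open>For a closed subspace \<open>S\<close>, the entries \<open>\<alpha>\<close>, \<open>\<beta>\<close>, \<open>\<gamma>\<close>, \<open>\<delta>\<close> are meant to be linear relations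
  from \<open>S\<close> to \<open>S\<close>, from \<open>S\<^sup>\<bottom>\<close> to \<open>S\<close>, from \<open>S\<close> to \<open>S\<^sup>\<bottom>\<close> and from \<open>S\<^sup>\<bottom>\<close> to \<open>S\<^sup>\<bottom>\<close>; the set \<open>S\<close>
  enters only through them.\<close>

definition block_matrix ::
    "('a::plus \<times> 'a) set \<Rightarrow> ('a \<times> 'a) set \<Rightarrow> ('a \<times> 'a) set \<Rightarrow> ('a \<times> 'a) set \<Rightarrow> ('a \<times> 'a) set"
  where "block_matrix \<alpha> \<beta> \<gamma> \<delta> =
    {(x1 + x2, (w1 + z1) + (w2 + z2)) | x1 x2 w1 z1 w2 z2.
       (x1, w1) \<in> \<alpha> \<and> (x2, z1) \<in> \<beta> \<and> (x1, w2) \<in> \<gamma> \<and> (x2, z2) \<in> \<delta>}"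

definition zero_on :: "'a set \<Rightarrow> ('a \<times> 'b::zero) set"
  where "zero_on M = M \<times> {0}"

end

(* For a vector s + y with s in S and y orthogonal to S, the S-component of W (s + y) is a s + b y.
   Hence s + y lies in (WS)^\<bottom> iff a (-s) = b y, that is, x and a^{-1} b are the same relation.
   Both W being S-complementable and a x = b then say that this relation is defined on all of
   S^\<bottom>. *)
theory Submission
  imports Defs
begin

section \<open>Orthogonal complements and orthogonal sums\<close>

lemma cinner_zero_left: "cinner 0 (y :: 'a::complex_inner) = 0"
  using cinner_add_left[of 0 0 y] by simp

lemma csubspace_orth_compl: "csubspace (orth_compl (S :: 'a::complex_inner set))"
  by (auto simp: complex_vector.subspace_def orth_compl_def cinner_add_left cinner_scaleC_left
      cinner_zero_left)

lemma inter_orth_compl_eq_zero: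
  fixes v :: "'a::complex_inner"
  assumes "v \<in> S" "v \<in> orth_compl S"
  shows "v = 0"
proof -
  have "cinner v v = 0"
    using assms by (simp add: orth_compl_def)
  then show ?thesis
    using Re_cinner[of v v] by simp
qed

lemma orth_sum_unique:
  fixes s :: "'a::complex_inner"
  assumes S: "csubspace S"
    and "s \<in> S" "s' \<in> S" "y \<in> orth_compl S" "y' \<in> orth_compl S" "s + y = s' + y'"
  shows "s = s' \<and> y = y'"
proof -
  have eq: "s - s' = y' - y"
    using assms by (simp add: algebra_simps)
  have "s - s' \<in> S"
    using assms by (simp add: complex_vector.subspace_diff)
  moreover have "s - s' \<in> orth_compl S"
    unfolding eq using assms by (simp add: complex_vector.subspace_diff csubspace_orth_compl)
  ultimately have "s - s' = 0"
    by (rule inter_orth_compl_eq_zero)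
  with eq show ?thesis
    by simp
qed

text \<open>The splitting \<open>decomp\<close> replaces an appeal to the projection theorem. It
  reduces the nontrivial inclusion to showing that the second component of a vector of the double
  complement vanishes.\<close>

lemma orth_compl_orth_compl:
  fixes S :: "'a::complex_inner set"
  assumes S: "csubspace S"
    and decomp: "\<And>v. \<exists>s\<in>S. \<exists>y\<in>orth_compl S. v = s + y"
  shows "orth_compl (orth_compl S) = S"
proof
  show "S \<subseteq> orth_compl (orth_compl S)"
  proof
    fix s assume s: "s \<in> S"
    have "cinner s y = 0" if "y \<in> orth_compl S" for y
      using that s cinner_commute[of s y] by (simp add: orth_compl_def)
    then show "s \<in> orth_compl (orth_compl S)"
      by (simp add: orth_compl_def)
  qed
  then have sub: "s \<in> orth_compl (orth_compl S)" if "s \<in> S" for s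
    using that by blast
  show "orth_compl (orth_compl S) \<subseteq> S"
  proof
    fix v assume v: "v \<in> orth_compl (orth_compl S)"
    obtain s y where sy: "s \<in> S" "y \<in> orth_compl S" "v = s + y"
      using decomp by blast
    \<comment> \<open>This difference is \<open>y\<close>, which therefore lies in
      \<open>orth_compl S\<close> and is orthogonal to it.\<close>
    have "v - s \<in> orth_compl (orth_compl S)"
      using v sub[OF sy(1)] by (simp add: complex_vector.subspace_diff csubspace_orth_compl)
    then have "y = 0"
      using sy inter_orth_compl_eq_zero[of y "orth_compl S"] by simp
    then show "v \<in> S"
      using sy by simp
  qed
qed

section \<open>The space (WS)^perp, block forms and complementability\<close>

lemma mem_W_orth_iff: "v \<in> W_orth W S \<longleftrightarrow> W v \<in> orth_compl S"
  by (simp add: W_orth_def orth_compl_def)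

text \<open>The inverse of the restricted projection lifts \<open>y\<close> to every vector
  \<open>s + y\<close> of \<open>L\<close>, and the negated projection then reads off
  \<open>- s\<close>.\<close>

lemma neg_proj_comp_inverse_proj:
  fixes S :: "'a::complex_inner set"
  assumes S: "csubspace S"
    and decomp: "\<And>v. \<exists>s\<in>S. \<exists>y\<in>orth_compl S. v = s + y"
  shows "rel_uminus (orth_proj S) \<circ>\<^sub>r (rel_restrict (orth_proj (orth_compl S)) L)\<inverse>
    = {(y, - s) | y s. y \<in> orth_compl S \<and> s \<in> S \<and> s + y \<in> L}" (is "?x = ?R")
proof
  show "?R \<subseteq> ?x"
  proof
    fix p assume "p \<in> ?R"
    then obtain y s where p: "p = (y, - s)" and sy: "y \<in> orth_compl S" "s \<in> S" "s + y \<in> L"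
      by blast
    \<comment> \<open>The second summand in \<open>orth_proj (orth_compl S)\<close> ranges over the
      double complement, which is \<open>S\<close>.\<close>
    have "(y + s, y) \<in> orth_proj (orth_compl S)"
      using sy by (auto simp: orth_proj_def proj_rel_def orth_compl_orth_compl[OF S decomp])
    then have "(s + y, y) \<in> rel_restrict (orth_proj (orth_compl S)) L"
      using sy by (simp add: rel_restrict_def add.commute)
    moreover have "(s + y, - s) \<in> rel_uminus (orth_proj S)"
      using sy by (auto simp: rel_uminus_def orth_proj_def proj_rel_def)
    ultimately show "p \<in> ?x"
      unfolding p rel_mult_def by blast
  qed
next
  show "?x \<subseteq> ?R"
  proof
    fix p assume "p \<in> ?x"
    then obtain y v w where p: "p = (y, w)"
      and vy: "(v, y) \<in> rel_restrict (orth_proj (orth_compl S)) L"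
      and vw: "(v, w) \<in> rel_uminus (orth_proj S)"
      unfolding rel_mult_def by blast
    obtain s where s: "s \<in> S" "y \<in> orth_compl S" "v = y + s" "v \<in> L"
      using vy by (auto simp: rel_restrict_def orth_proj_def proj_rel_def
          orth_compl_orth_compl[OF S decomp])
    obtain s' y' where s': "s' \<in> S" "y' \<in> orth_compl S" "v = s' + y'" "w = - s'"
      using vw by (auto simp: rel_uminus_def orth_proj_def proj_rel_def)
    have "s + y = s' + y'"
      using s(3) s'(3) by (simp add: add.commute)
    then have "s' = s"
      using orth_sum_unique[OF S s(1) s'(1) s(2) s'(2)] by simp
    with s s' show "p \<in> ?R"
      unfolding p by (auto simp: add.commute)
  qed
qed

text \<open>If n = s + y, then m + n has the S-component t = m + s, so the projected vector is m = t
  - s. The identity entry contributes t and the entry \<open>?R\<close> contributes - s.\<close>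

lemma proj_rel_eq_block_matrix:
  fixes S :: "'a::complex_inner set"
  assumes S: "csubspace S"
    and decomp: "\<And>v. \<exists>s\<in>S. \<exists>y\<in>orth_compl S. v = s + y"
  shows "proj_rel S L = block_matrix (Id_on S)
    {(y, - s) | y s. y \<in> orth_compl S \<and> s \<in> S \<and> s + y \<in> L} (zero_on S) (zero_on (orth_compl S))"
    (is "_ = block_matrix _ ?R _ _")
proof
  show "proj_rel S L \<subseteq> block_matrix (Id_on S) ?R (zero_on S) (zero_on (orth_compl S))"
  proof
    fix p assume "p \<in> proj_rel S L"
    then obtain m n where p: "p = (m + n, m)" and mn: "m \<in> S" "n \<in> L"
      by (auto simp: proj_rel_def)
    obtain s y where sy: "s \<in> S" "y \<in> orth_compl S" "n = s + y"
      using decomp by blast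
    have "(m + s, m + s) \<in> Id_on S" "(m + s, 0) \<in> zero_on S"
      using mn sy S by (auto simp: zero_on_def complex_vector.subspace_add)
    moreover have "(y, - s) \<in> ?R" "(y, 0) \<in> zero_on (orth_compl S)"
      using mn sy by (auto simp: zero_on_def)
    moreover have "p = ((m + s) + y, ((m + s) + - s) + (0 + 0))"
      using p sy by (simp add: algebra_simps)
    ultimately show "p \<in> block_matrix (Id_on S) ?R (zero_on S) (zero_on (orth_compl S))"
      unfolding block_matrix_def by blast
  qed
next
  show "block_matrix (Id_on S) ?R (zero_on S) (zero_on (orth_compl S)) \<subseteq> proj_rel S L"
  proof
    fix p assume "p \<in> block_matrix (Id_on S) ?R (zero_on S) (zero_on (orth_compl S))"
    then obtain t y s where p: "p = (t + y, t + - s)"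
      and ts: "t \<in> S" "s \<in> S" "s + y \<in> L"
      by (auto simp: block_matrix_def zero_on_def)
    have "t - s \<in> S" "p = ((t - s) + (s + y), t - s)"
      using p ts S by (simp_all add: complex_vector.subspace_diff)
    with ts show "p \<in> proj_rel S L"
      unfolding proj_rel_def by blast
  qed
qed

text \<open>Since \<open>d\<close> and \<open>c\<close> take values in the complement,
  \<open>u + v\<close> is the S-component of \<open>W (s + y)\<close>, and a vector is orthogonal to
  \<open>S\<close> iff its S-component is zero.\<close>

lemma block_matrix_mem_W_orth_iff:
  fixes S :: "'a::complex_inner set"
  assumes S: "csubspace S"
    and a: "a \<subseteq> S \<times> S" "single_valued a"
    and b: "b \<subseteq> orth_compl S \<times> S" "single_valued b"
    and d: "d \<subseteq> S \<times> orth_compl S" and c: "c \<subseteq> orth_compl S \<times> orth_compl S"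
    and W: "graph W = block_matrix a b d c"
    and u: "(s, u) \<in> a" and v: "(y, v) \<in> b"
  shows "s + y \<in> W_orth W S \<longleftrightarrow> u + v = 0"
proof -
  have "(s + y, W (s + y)) \<in> block_matrix a b d c"
    unfolding W[symmetric] graph_def by blast
  then obtain s' y' w1 z1 w2 z2 where sum: "s + y = s' + y'"
    and Wsy: "W (s + y) = (w1 + z1) + (w2 + z2)"
    and mem: "(s', w1) \<in> a" "(y', z1) \<in> b" "(s', w2) \<in> d" "(y', z2) \<in> c"
    unfolding block_matrix_def by blast
  \<comment> \<open>The block matrix only yields some splitting of the argument. Uniqueness
    identifies it with the given one, after which single-valuedness identifies the images.\<close>
  have "s = s' \<and> y = y'"
    by (rule orth_sum_unique[OF S _ _ _ _ sum]) (use a b u v mem in auto)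
  with mem u v a b have uv: "w1 = u" "z1 = v"
    by (auto dest: single_valuedD)
  have r: "w2 + z2 \<in> orth_compl S"
    using mem c d by (auto intro!: complex_vector.subspace_add csubspace_orth_compl)
  have "u + v \<in> S"
    using u v a b S by (auto intro!: complex_vector.subspace_add)
  moreover have "0 \<in> orth_compl S"
    using csubspace_orth_compl complex_vector.subspace_0 by blast
  ultimately have "u + v = 0 \<longleftrightarrow> u + v \<in> orth_compl S"
    using inter_orth_compl_eq_zero by metis
  \<comment> \<open>The two vectors differ by \<open>w2 + z2\<close>, an element of this
    subspace.\<close>
  also have "\<dots> \<longleftrightarrow> W (s + y) \<in> orth_compl S"
    using r complex_vector.subspace_add[OF csubspace_orth_compl, of "u + v" S "w2 + z2"]
      complex_vector.subspace_diff[OF csubspace_orth_compl, of "W (s + y)" S "w2 + z2"]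
    unfolding Wsy uv by auto
  finally show ?thesis
    by (simp add: mem_W_orth_iff)
qed

text \<open>Since \<open>S\<close> is itself one of the two summands, the S-component of a vector
  can be adjusted freely, and only vectors of the complement have to be tested.\<close>

lemma complementable_iff:
  fixes S :: "'a::complex_inner set"
  assumes S: "csubspace S"
    and decomp: "\<And>v. \<exists>s\<in>S. \<exists>y\<in>orth_compl S. v = s + y"
  shows "complementable W S \<longleftrightarrow> (\<forall>y\<in>orth_compl S. \<exists>s\<in>S. s + y \<in> W_orth W S)"
proof -
  have dom: "complementable W S \<longleftrightarrow> (\<forall>v. \<exists>m\<in>S. \<exists>n\<in>W_orth W S. v = m + n)"
    unfolding complementable_def W_proj_def proj_rel_def by blast
  show ?thesis
  proof
    assume "complementable W S"
    show "\<forall>y\<in>orth_compl S. \<exists>s\<in>S. s + y \<in> W_orth W S"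
    proof
      fix y
      obtain m n where mn: "m \<in> S" "n \<in> W_orth W S" "y = m + n"
        using \<open>complementable W S\<close> dom by blast
      moreover have "- m \<in> S"
        using mn S by (simp add: complex_vector.subspace_neg)
      ultimately show "\<exists>s\<in>S. s + y \<in> W_orth W S"
        by (intro bexI[of _ "- m"]) simp_all
    qed
  next
    assume ex: "\<forall>y\<in>orth_compl S. \<exists>s\<in>S. s + y \<in> W_orth W S"
    show "complementable W S"
      unfolding dom
    proof
      fix v
      obtain t y where ty: "t \<in> S" "y \<in> orth_compl S" "v = t + y"
        using decomp by blast
      obtain s where s: "s \<in> S" "s + y \<in> W_orth W S"
        using ex ty by blast
      have "t - s \<in> S" "v = (t - s) + (s + y)"
        using ty s S by (simp_all add: complex_vector.subspace_diff)
      with s show "\<exists>m\<in>S. \<exists>n\<in>W_orth W S. v = m + n"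
        by blast
    qed
  qed
qed

theorem proposition4p5:
  fixes S :: "'a::complex_hilbert_space set"
    and W :: "'a \<Rightarrow> 'a"
    and a b c x :: "('a \<times> 'a) set"
  assumes "separable_space (euclidean :: 'a topology)"
    and "csubspace S" and "closed S"
    and "bounded_clinear W" and "selfadjoint W"
    and "bounded_operator S S a"
    and "bounded_operator (orth_compl S) S b"
    and "bounded_operator (orth_compl S) (orth_compl S) c"
    and "graph W = block_matrix a b (rel_adjoint (orth_compl S) S b) c"
    and "x = rel_uminus (orth_proj S) \<circ>\<^sub>r (rel_restrict (orth_proj (orth_compl S)) (W_orth W S))\<inverse>"
  shows "W_proj W S = block_matrix (Id_on S) x (zero_on S) (zero_on (orth_compl S))
    \<and> (complementable W S \<longleftrightarrow> a \<circ>\<^sub>r x = b)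
    \<and> (complementable W S \<longrightarrow>
         W_proj W S = block_matrix (Id_on S) (a\<inverse> \<circ>\<^sub>r b) (zero_on S) (zero_on (orth_compl S)))"
proof -
  note S = \<open>csubspace S\<close>
  let ?T = "orth_compl S"
  have a: "csubspace a" "a \<subseteq> S \<times> S" "single_valued a" "Domain a = S"
    using assms by (auto simp: bounded_operator_def linear_relation_def)
  have b: "b \<subseteq> ?T \<times> S" "single_valued b" "Domain b = ?T"
    using assms by (auto simp: bounded_operator_def linear_relation_def)
  have c: "c \<subseteq> ?T \<times> ?T"
    using assms by (auto simp: bounded_operator_def linear_relation_def)
  have d: "rel_adjoint ?T S b \<subseteq> S \<times> ?T"
    by (auto simp: rel_adjoint_def)
  note W = \<open>graph W = block_matrix a b (rel_adjoint ?T S b) c\<close>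
  \<comment> \<open>The splitting is read off the representation of \<open>W\<close>: its graph
    contains a pair with first entry \<open>v\<close>, and the block matrix writes \<open>v\<close>
    as a sum of arguments of \<open>a\<close> and \<open>b\<close>.\<close>
  have decomp: "\<exists>s\<in>S. \<exists>y\<in>?T. v = s + y" for v
  proof -
    have "(v, W v) \<in> block_matrix a b (rel_adjoint ?T S b) c"
      unfolding W[symmetric] graph_def by blast
    then show ?thesis
      unfolding block_matrix_def using a(2) b(1) by blast
  qed
  have x: "x = {(y, - s) | y s. y \<in> ?T \<and> s \<in> S \<and> s + y \<in> W_orth W S}"
    unfolding assms(10) by (rule neg_proj_comp_inverse_proj[OF S decomp])
  have a_neg: "(- s, - u) \<in> a" if "(s, u) \<in> a" for s u
    using complex_vector.subspace_neg[OF a(1) that] by simp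
  note iff = block_matrix_mem_W_orth_iff[OF S a(2,3) b(1,2) d c W]
  \<comment> \<open>Besides giving the final formula, this turns a x = b into a question about the
    domain of \<open>x\<close>.\<close>
  have x_eq: "x = a\<inverse> \<circ>\<^sub>r b"
  proof
    show "x \<subseteq> a\<inverse> \<circ>\<^sub>r b"
    proof
      fix p assume "p \<in> x"
      then obtain y s where p: "p = (y, - s)" and sy: "y \<in> ?T" "s \<in> S" "s + y \<in> W_orth W S"
        unfolding x by blast
      obtain u v where uv: "(s, u) \<in> a" "(y, v) \<in> b"
        using sy a(4) b(3) by blast
      then have "v = - u"
        using iff[OF uv] sy by (simp add: eq_neg_iff_add_eq_0 add.commute)
      then show "p \<in> a\<inverse> \<circ>\<^sub>r b"
        using a_neg[OF uv(1)] uv(2) unfolding p rel_mult_def by blast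
    qed
  next
    show "a\<inverse> \<circ>\<^sub>r b \<subseteq> x"
    proof
      fix p assume "p \<in> a\<inverse> \<circ>\<^sub>r b"
      then obtain y s v where p: "p = (y, s)" and yv: "(y, v) \<in> b" and sv: "(s, v) \<in> a"
        unfolding rel_mult_def by blast
      have "- s + y \<in> W_orth W S"
        using iff[OF a_neg[OF sv] yv] by simp
      moreover have "- s \<in> S" "y \<in> ?T"
        using a_neg[OF sv] yv a(2) b(1) by auto
      ultimately have "(y, - (- s)) \<in> x"
        unfolding x by blast
      then show "p \<in> x"
        unfolding p by simp
    qed
  qed
  have proj: "W_proj W S = block_matrix (Id_on S) x (zero_on S) (zero_on ?T)"
    unfolding W_proj_def x by (rule proj_rel_eq_block_matrix[OF S decomp])
  have "complementable W S \<longleftrightarrow> ?T \<subseteq> Domain x"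
    unfolding complementable_iff[OF S decomp] x by blast
  also have "\<dots> \<longleftrightarrow> a \<circ>\<^sub>r x = b"
  proof
    assume dom: "?T \<subseteq> Domain x"
    show "a \<circ>\<^sub>r x = b"
    proof
      show "a \<circ>\<^sub>r x \<subseteq> b"
        \<comment> \<open>A pair of a a^{-1} b passes from y to v by \<open>b\<close>, back to some
          s with (s, v) in \<open>a\<close>, and forward by \<open>a\<close>, which returns to
          v.\<close>
        unfolding x_eq rel_mult_def using a(3) by (auto dest: single_valuedD)
      show "b \<subseteq> a \<circ>\<^sub>r x"
      proof
        fix p assume "p \<in> b"
        then obtain y v where p: "p = (y, v)" and yv: "(y, v) \<in> b"
          by (cases p) blast
        then obtain s where s: "(y, s) \<in> x"
          using dom b(1) by blast
        \<comment> \<open>Membership in a^{-1} b provides a common image of s under \<open>a\<close>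
          and of y under \<open>b\<close>; it equals \<open>v\<close> because \<open>b\<close> is
          single-valued.\<close>
        then have "(s, v) \<in> a"
          using yv b(2) unfolding x_eq rel_mult_def by (auto dest: single_valuedD)
        with s show "p \<in> a \<circ>\<^sub>r x"
          unfolding p rel_mult_def by blast
      qed
    qed
  next
    assume "a \<circ>\<^sub>r x = b"
    \<comment> \<open>The domain of the product lies in that of its first applied factor
      \<open>x\<close>, while \<open>b\<close> is defined on all of \<open>?T\<close>.\<close>
    then show "?T \<subseteq> Domain x"
      using b(3) unfolding rel_mult_def by blast
  qed
  finally show ?thesis
    using proj x_eq by simp
qed

end
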